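(* Let $n$ be a positive integer with $n\equiv 1\pmod 4$. Then, as a congruence of rational functions in $q$, $$\sum_{k=0}^{(n-1)/2}\frac{(q;q^2)_k^2\,(q^2;q^4)_k}{(q^2;q^2)_k^2\,(q^4;q^4)_k}\,q^{2k}\equiv q^{(n-1)/2}\,\frac{(q^2;q^4)_{(n-1)/4}^2}{(q^4;q^4)_{(n-1)/4}^2}\left\{1+2[n]^2\sum_{i=1}^{(n-1)/4}\frac{q^{4i-2}}{[4i-2]^2}\right\}\pmod{\Phi_n(q)^3}.$$
   Context: Here $q$ is an indeterminate. The $q$-shifted factorial is $(x;q)_0=1$ and $(x;q)_m=(1-x)(1-xq)\cdots(1-xq^{m-1})$ for $m\ge 1$; thus, for example, $(x;q^2)_m=\prod_{j=0}^{m-1}(1-xq^{2j})$ and $(x;q^4)_m=\prod_{j=0}^{m-1}(1-xq^{4j})$. For a positive integer $m$, $[m]=(1-q^m)/(1-q)=1+q+\cdots+q^{m-1}$ is the $q$-integer. $\Phi_n(q)=\prod_{1\le k\le n,\ \gcd(k,n)=1}(q-\zeta^k)$, with $\zeta$ a primitive $n$-th root of unity, is the $n$-th cyclotomic polynomial. An empty sum is $0$. For rational functions $A(q),B(q)\in\mathbb{Q}(q)$ and a polynomial $P(q)$, $A(q)\equiv B(q)\pmod{P(q)}$ means that, when $A(q)-B(q)$ is written in lowest terms, its numerator is divisible by $P(q)$ (and so its denominator is coprime to $P(q)$). *)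

theory Defs
  imports
    Complex_Main
    "HOL-Computational_Algebra.Polynomial_Factorial"
    "HOL-Computational_Algebra.Normalized_Fraction"
    "HOL-Computational_Algebra.Field_as_Ring"
begin

text \<open>The field \<open>\<rat>(q)\<close> is \<^typ>\<open>rat poly fract\<close>; \<open>qvar\<close> is the indeterminate.\<close>

definition qvar :: "rat poly fract" where
  "qvar = to_fract [:0, 1:]"

definition qfactorial :: "'a \<Rightarrow> 'a \<Rightarrow> nat \<Rightarrow> 'a::comm_ring_1" where
  "qfactorial x p m = (\<Prod>j<m. 1 - x * p ^ j)"

definition qint :: "nat \<Rightarrow> rat poly fract" where
  "qint m = (1 - qvar ^ m) / (1 - qvar)"

definition ccyclotomic :: "nat \<Rightarrow> complex poly" where
  "ccyclotomic n = (\<Prod>k\<in>{k. 1 \<le> k \<and> k \<le> n \<and> coprime k n}. [:- (cis (2 * pi / real n) ^ k), 1:])"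

text \<open>The cyclotomic polynomial has rational coefficients, so it descends to \<^typ>\<open>rat poly\<close>;
  the description is justified by \<open>map_poly_cyclotomic\<close> below.\<close>

definition cyclotomic :: "nat \<Rightarrow> rat poly" where
  "cyclotomic n = (THE p. map_poly of_rat p = ccyclotomic n)"

text \<open>\<^const>\<open>quot_of_fract\<close> returns numerator and denominator in lowest terms.\<close>

definition ratfun_cong :: "rat poly fract \<Rightarrow> rat poly fract \<Rightarrow> rat poly \<Rightarrow> bool" where
  "ratfun_cong A B P \<longleftrightarrow> P dvd fst (quot_of_fract (A - B))"


subsection \<open>Rationality of the cyclotomic polynomials\<close>

abbreviation cpoly :: "rat poly \<Rightarrow> complex poly" where
  "cpoly \<equiv> map_poly of_rat"

lemma coeff_cpoly: "coeff (cpoly p) i = of_rat (coeff p i)"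
  by (simp add: coeff_map_poly)

lemma cpoly_1: "cpoly 1 = 1"
  by (rule poly_eqI) (simp add: coeff_cpoly)

lemma cpoly_add: "cpoly (p + r) = cpoly p + cpoly r"
  by (rule poly_eqI) (simp add: coeff_cpoly of_rat_add)

lemma cpoly_mult: "cpoly (p * r) = cpoly p * cpoly r"
  by (rule poly_eqI) (simp add: coeff_cpoly coeff_mult of_rat_sum of_rat_mult)

lemma cpoly_inj: "cpoly p = cpoly r \<Longrightarrow> p = r"
  by (metis coeff_cpoly of_rat_eq_iff poly_eqI)

lemma degree_cpoly: "degree (cpoly p) = degree p"
  by (simp add: degree_map_poly)

lemma cpoly_monom_minus_1: "cpoly (monom 1 n - 1) = monom 1 n - 1"
  by (rule poly_eqI) (simp add: coeff_cpoly of_rat_diff)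

lemma monom_minus_1_eq_prod:
  assumes "n > 0"
  shows "monom 1 n - 1 = (\<Prod>k\<in>{1..n}. [:- (cis (2 * pi / real n) ^ k), 1:])"
proof -
  let ?z = "cis (2 * pi / real n)"
  let ?P = "\<Prod>k\<in>{1..n}. [:- (?z ^ k), 1:]"
  have zn: "?z ^ n = 1" using assms by (simp add: DeMoivre)
  have eq: "(\<lambda>k. ?z ^ k) ` {1..n} = {z. z ^ n = 1}"
  proof -
    have "{z. z ^ n = 1} = (\<lambda>k. cis (2 * pi * real k / real n)) ` {..<n}"
      using bij_betw_roots_unity[OF assms] by (simp add: bij_betw_def)
    also have "\<dots> = (\<lambda>k. ?z ^ k) ` {..<n}"
      by (intro image_cong refl) (simp add: DeMoivre mult_ac)
    also have "\<dots> = (\<lambda>k. ?z ^ k) ` {1..n}"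
    proof -
      have "?z ^ k \<in> (\<lambda>k. ?z ^ k) ` {1..n}" if "k < n" for k
      proof (cases "k = 0")
        case True
        then have "?z ^ k = ?z ^ n" using zn by simp
        then show ?thesis using assms by fastforce
      qed (use that in auto)
      moreover have "?z ^ k \<in> (\<lambda>k. ?z ^ k) ` {..<n}" if "k \<in> {1..n}" for k
      proof (cases "k = n")
        case True
        then have "?z ^ k = ?z ^ 0" using zn by simp
        then show ?thesis using assms by blast
      qed (use that in auto)
      ultimately show ?thesis by blast
    qed
    finally show ?thesis by simp
  qed
  have deg: "degree ?P = n" by (subst degree_prod_eq_sum_degree) auto
  show ?thesis
  proof (rule poly_eqI_degree_lead_coeff[where n = n and A = "{z. z ^ n = 1}"])
    have "lead_coeff ?P = 1" by (simp add: lead_coeff_prod)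
    then show "coeff (monom 1 n - 1) n = coeff ?P n" using assms deg by simp
    show "degree (monom 1 n - 1 :: complex poly) \<le> n"
      by (rule degree_diff_le) (auto simp: degree_monom_le)
    show "degree ?P \<le> n" using deg by simp
    show "n \<le> card {z :: complex. z ^ n = 1}" using card_roots_unity_eq[OF assms] by simp
    fix z :: complex assume z: "z \<in> {z. z ^ n = 1}"
    then obtain k where "k \<in> {1..n}" "z = ?z ^ k" using eq by blast
    then have "poly ?P z = 0" by (auto simp: poly_prod)
    then show "poly (monom 1 n - 1) z = poly ?P z" using z by (simp add: poly_monom)
  qed
qed

lemma monom_minus_1_eq_prod_ccyclotomic:
  assumes "n > 0"
  shows "monom 1 n - 1 = (\<Prod>d\<in>{d. d dvd n}. ccyclotomic d)"
proof -
  let ?f = "\<lambda>k. [:- (cis (2 * pi / real n) ^ k), 1:]"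
  have "(\<Prod>d\<in>{d. d dvd n}. ccyclotomic d) =
        (\<Prod>d\<in>{d. d dvd n}. \<Prod>k\<in>{k\<in>{1..n}. n div gcd k n = d}. ?f k)"
  proof (rule prod.cong[OF refl])
    fix d assume "d \<in> {d. d dvd n}"
    then obtain e where e: "n = d * e" by auto
    with assms have pos: "d > 0" "e > 0" by auto
    have "{k\<in>{1..n}. n div gcd k n = d} = (\<lambda>j. j * e) ` {j. 1 \<le> j \<and> j \<le> d \<and> coprime j d}"
    proof (intro equalityI subsetI)
      fix k assume "k \<in> {k\<in>{1..n}. n div gcd k n = d}"
      then have k: "1 \<le> k" "k \<le> n" "n div gcd k n = d" by auto
      have "gcd k n * d = n" using k(3) by (metis dvd_mult_div_cancel gcd_dvd2)
      then have g: "gcd k n = e" using e pos by (metis mult.commute mult_cancel2 less_irrefl)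
      then obtain j where j: "k = j * e" by (metis dvd_div_mult_self gcd_dvd1)
      have "gcd j d * e = e" using g unfolding j e by (metis gcd_mult_distrib_nat mult.commute)
      then have "coprime j d" using pos by (simp add: coprime_iff_gcd_eq_1)
      moreover have "1 \<le> j" "j \<le> d" using k(1,2) pos unfolding j e by (auto simp: Suc_le_eq)
      ultimately show "k \<in> (\<lambda>j. j * e) ` {j. 1 \<le> j \<and> j \<le> d \<and> coprime j d}"
        using j by blast
    next
      fix k assume "k \<in> (\<lambda>j. j * e) ` {j. 1 \<le> j \<and> j \<le> d \<and> coprime j d}"
      then obtain j where j: "k = j * e" "1 \<le> j" "j \<le> d" "coprime j d" by auto
      have "gcd k n = gcd j d * e" unfolding j e by (metis gcd_mult_distrib_nat mult.commute)
      then have "gcd k n = e" using j(4) by simp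
      then show "k \<in> {k\<in>{1..n}. n div gcd k n = d}" using j pos e by auto
    qed
    moreover have "inj_on (\<lambda>j. j * e) {j. 1 \<le> j \<and> j \<le> d \<and> coprime j d}"
      using pos by (auto intro: inj_onI)
    ultimately have "(\<Prod>k\<in>{k\<in>{1..n}. n div gcd k n = d}. ?f k) =
        (\<Prod>j\<in>{j. 1 \<le> j \<and> j \<le> d \<and> coprime j d}. ?f (j * e))"
      by (simp add: prod.reindex)
    also have "\<dots> = ccyclotomic d"
      unfolding ccyclotomic_def
    proof (rule prod.cong[OF refl])
      fix j
      have "real j * real e * (2 * pi / real n) = real j * (2 * pi / real d)"
        using pos by (simp add: e field_simps)
      then show "?f (j * e) = [:- (cis (2 * pi / real d) ^ j), 1:]"
        by (simp add: DeMoivre)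
    qed
    finally show "ccyclotomic d = (\<Prod>k\<in>{k\<in>{1..n}. n div gcd k n = d}. ?f k)" ..
  qed
  also have "\<dots> = (\<Prod>k\<in>{1..n}. ?f k)"
  proof (rule prod.group)
    show "(\<lambda>k. n div gcd k n) ` {1..n} \<subseteq> {d. d dvd n}"
      by (auto intro: div_dvd_iff_mult[THEN iffD2])
  qed (use assms in auto)
  finally show ?thesis using monom_minus_1_eq_prod[OF assms] by simp
qed

lemma ccyclotomic_nonzero: "ccyclotomic n \<noteq> 0"
  unfolding ccyclotomic_def by (subst prod_zero_iff) auto

lemma ccyclotomic_rational: "\<exists>p. cpoly p = ccyclotomic n"
proof (induction n rule: less_induct)
  case (less n)
  show ?case
  proof (cases "n = 0")
    case True
    then have "{k. 1 \<le> k \<and> k \<le> n \<and> coprime k n} = {}" by auto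
    then have "cpoly 1 = ccyclotomic n" by (simp only: ccyclotomic_def cpoly_1 prod.empty)
    then show ?thesis ..
  next
    case False
    let ?D = "{d. d dvd n}"
    have fin: "finite ?D" using False by simp
    define B where "B = (\<Prod>d\<in>?D - {n}. ccyclotomic d)"
    have eq: "monom 1 n - 1 = ccyclotomic n * B"
      using False fin by (simp add: monom_minus_1_eq_prod_ccyclotomic B_def prod.remove[of ?D n])
    have B0: "B \<noteq> 0"
      unfolding B_def using fin by (simp add: prod_zero_iff ccyclotomic_nonzero)
    have "\<exists>b. cpoly b = (\<Prod>d\<in>S. ccyclotomic d)" if "S \<subseteq> ?D - {n}" for S
    proof -
      have "finite S" using that fin by (meson finite_Diff finite_subset)
      then show ?thesis using that
      proof (induction S rule: finite_induct)
        case empty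
        have "cpoly 1 = (\<Prod>d\<in>{}. ccyclotomic d)" by (simp add: cpoly_1)
        then show ?case ..
      next
        case (insert x S)
        then obtain b where b: "cpoly b = (\<Prod>d\<in>S. ccyclotomic d)" by blast
        have "x < n" using insert.prems False by (auto dest: dvd_imp_le)
        then obtain p where p: "cpoly p = ccyclotomic x" using less.IH by blast
        have "cpoly (p * b) = (\<Prod>d\<in>insert x S. ccyclotomic d)"
          using insert.hyps by (simp add: b p cpoly_mult)
        then show ?case ..
      qed
    qed
    then obtain b where b: "cpoly b = B" unfolding B_def by blast
    define a :: "rat poly" where "a = monom 1 n - 1"
    have b0: "b \<noteq> 0" using b B0 by auto
    have "cpoly a = ccyclotomic n * B"
      using eq by (simp add: a_def cpoly_monom_minus_1)
    moreover have "cpoly a = B * cpoly (a div b) + cpoly (a mod b)"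
      by (metis b cpoly_add cpoly_mult mult_div_mod_eq)
    ultimately have r: "cpoly (a mod b) = B * (ccyclotomic n - cpoly (a div b))"
      by (simp add: algebra_simps)
    have "ccyclotomic n - cpoly (a div b) = 0"
    proof (rule ccontr)
      assume nz: "ccyclotomic n - cpoly (a div b) \<noteq> 0"
      then have "a mod b \<noteq> 0" using r B0 by auto
      then have "degree (a mod b) < degree b" using degree_mod_less[OF b0] by blast
      moreover have "degree (a mod b) = degree b + degree (ccyclotomic n - cpoly (a div b))"
        using arg_cong[OF r, of degree] nz B0 b degree_cpoly[of b]
        by (simp add: degree_cpoly degree_mult_eq)
      ultimately show False by simp
    qed
    then have "cpoly (a div b) = ccyclotomic n" by simp
    then show ?thesis ..
  qed
qed

lemma map_poly_cyclotomic: "map_poly of_rat (cyclotomic n) = ccyclotomic n"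
proof -
  have "\<exists>!p. cpoly p = ccyclotomic n"
    using ccyclotomic_rational cpoly_inj by metis
  then show ?thesis unfolding cyclotomic_def by (rule theI')
qed

end

theory Submission
  imports
    Defs
    "HOL-Computational_Algebra.Fundamental_Theorem_Algebra"
begin

text \<open>
  Replace the two factors \<open>(q;q\<^sup>2)\<^sub>k\<close> of the summand by
  \<open>(a q;q\<^sup>2)\<^sub>k (q/a;q\<^sup>2)\<^sub>k = \<Prod>j<k. (1 - u q^(2j+1) + q^(4j+2))\<close>, where \<open>u = a + 1/a\<close>.
  The sum becomes a polynomial \<open>S(u)\<close> (\<open>deformed_sum\<close>) whose value at \<open>u = 2\<close> is the left-hand side.
  Write \<open>n = 4 M + 1\<close>, so that \<open>S\<close> has degree at most \<open>2 M\<close>.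

  At the nodes \<open>u\<^sub>N = q^(2N+1) + q^(-2N-1)\<close> the sum terminates after \<open>N\<close> steps. In base \<open>p = q\<^sup>2\<close> it
  is a case of Andrews' \<open>q\<close>-analogue of Watson's \<open>\<^sub>3F\<^sub>2\<close> summation: it vanishes for odd \<open>N\<close>, and for
  \<open>N = 2 J\<close> it equals \<open>p^J ((p;p\<^sup>2)\<^sub>J / (p\<^sup>2;p\<^sup>2)\<^sub>J)\<^sup>2\<close>. Both follow from a recurrence linking \<open>N\<close> and
  \<open>N + 2\<close>, found by creative telescoping (\<open>gosper_telescoping\<close>, \<open>legendre_sum_rec\<close>). For \<open>N = 2 M\<close> the
  node is \<open>u\<^sub>* = q^n + q^(-n)\<close>, and \<open>S(u\<^sub>*)\<close> is the factor in front of the braces on the right-hand side.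

  Since \<open>2 - u\<^sub>* = - (1 - q^n)\<^sup>2 / q^n\<close> is divisible by \<open>\<Phi>\<^sub>n\<^sup>2\<close>, this settles the congruence modulo
  \<open>\<Phi>\<^sub>n\<^sup>2\<close>, and for \<open>\<Phi>\<^sub>n\<^sup>3\<close> only the difference quotient
  \<open>(S(2) - S(u\<^sub>*)) / (2 - u\<^sub>*)\<close> modulo \<open>\<Phi>\<^sub>n\<close> is still needed. At a primitive \<open>n\<close>-th root of unity
  \<open>u\<^sub>*\<close> becomes \<open>2\<close>, so this quotient is the derivative \<open>S'(2)\<close>.

  At such a root \<open>S\<close> is explicit: up to a constant it is the square of
  \<open>\<Prod>i<M. (1 - u q^(4i+2) + q^(8i+4))\<close> (\<open>deformed_sum_at_root\<close>). Both sides have degree at most \<open>2 M\<close>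
  and agree at the \<open>2 M + 1\<close> nodes \<open>u\<^sub>0, \<dots>, u\<^sub>2\<^sub>M\<close>, which are distinct there. The logarithmic derivative
  of the square at \<open>u = 2\<close> is \<open>- 2 (\<Sum>i<M. q^(4i+2) / (1 - q^(4i+2))\<^sup>2)\<close>, the sum inside the braces.
\<close>

section \<open>A terminating q-Watson summation\<close>

lemma qfactorial_0: "qfactorial x p 0 = 1"
  by (simp add: qfactorial_def)

lemma qfactorial_Suc: "qfactorial x p (Suc k) = qfactorial x p k * (1 - x * p ^ k)"
  by (simp add: qfactorial_def)

lemma qfactorial_Suc_shift: "qfactorial x p (Suc k) = (1 - x) * qfactorial (x * p) p k"
  unfolding qfactorial_def by (subst prod.lessThan_Suc_shift) (simp add: mult_ac)

lemma qfactorial_nonzero: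
  fixes x :: "'a::idom"
  shows "(\<And>j. j < k \<Longrightarrow> x * p ^ j \<noteq> 1) \<Longrightarrow> qfactorial x p k \<noteq> 0"
  by (auto simp: qfactorial_def)

lemma qfactorial_inverse_power_eq_0:
  fixes p :: "'a::field"
  assumes "p \<noteq> 0" "N < k"
  shows "qfactorial (inverse (p ^ N)) p k = 0"
  unfolding qfactorial_def using assms by (auto intro!: bexI[of _ N])

definition legendre_weight :: "'a::field \<Rightarrow> nat \<Rightarrow> 'a" where
  "legendre_weight p k =
     qfactorial p (p^2) k / (qfactorial p p k ^ 2 * qfactorial (p^2) (p^2) k) * p ^ k"

text \<open>
  The value of a little \<open>q\<close>-Legendre polynomial \<open>\<Sum>k. (p^(-N);p)\<^sub>k (p^(N+1);p)\<^sub>k / (p;p)\<^sub>k\<^sup>2 (p x)^k\<close> under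
  the functional \<open>x^k \<mapsto> (p;p\<^sup>2)\<^sub>k / (p\<^sup>2;p\<^sup>2)\<^sub>k\<close>.
\<close>

definition legendre_sum :: "'a::field \<Rightarrow> nat \<Rightarrow> 'a" where
  "legendre_sum p N =
     (\<Sum>k\<le>N. qfactorial (inverse (p ^ N)) p k * qfactorial (p ^ Suc N) p k * legendre_weight p k)"

lemma legendre_weight_Suc:
  fixes p :: "'a::field"
  assumes "p ^ Suc k \<noteq> 1" "p ^ (2 * Suc k) \<noteq> 1"
  shows "legendre_weight p (Suc k) * ((1 - p * p ^ k)^2 * (1 - p^2 * (p^k)^2)) =
         legendre_weight p k * (1 - p * (p^k)^2) * p"
proof -
  have 1: "1 - p * p ^ k \<noteq> 0" using assms(1) by simp
  have 2: "1 - p^2 * (p^k)^2 \<noteq> 0" 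
    using assms(2) by (simp add: power_mult power_mult_distrib power2_eq_square mult_ac power_add)
  have e: "(p^2)^k = (p^k)^2" by (simp add: power_mult [symmetric] mult.commute)
  show ?thesis
    unfolding legendre_weight_def qfactorial_Suc e using 1 2
    by (simp add: power_mult_distrib divide_simps) 
qed

text \<open>
  With \<open>a = p^(-N-2)\<close> and \<open>b = p^(N+1)\<close>, the summands of \<open>legendre_sum p (N + 2)\<close> and \<open>legendre_sum p N\<close>
  are, up to factors free of \<open>k\<close>, the common term \<open>(a;p)\<^sub>k (b;p)\<^sub>k w\<^sub>k\<close> (with \<open>w\<^sub>k\<close> the weight) times
  \<open>(1 - b K) (1 - b p K)\<close> and \<open>(1 - a K) (1 - a p K)\<close>, where \<open>K = p^k\<close>. Gosper's equation for a
  combination with coefficients \<open>\<alpha>\<close> and \<open>-\<beta>\<close> then has a solution of the form \<open>x / K\<close>: because \<open>a b p = 1\<close>, the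
  terms of degree four in \<open>K\<close> cancel. The three equations assumed on \<open>\<alpha>\<close>, \<open>\<beta>\<close> and \<open>x\<close> compare the
  coefficients of \<open>1\<close>, \<open>K\<close> and \<open>K\<^sup>2\<close>, the second one divided by \<open>1 + p\<close> and all up to powers of \<open>p\<close>.
\<close>

lemma gosper_telescoping:
  fixes p a b :: "'a::field"
  assumes p0: "p \<noteq> 0" and ab: "a * b * p = 1"
    and alpha: "\<alpha> - \<beta> = x * (2 - (a + b))"
    and beta: "p * (\<beta> * a - \<alpha> * b) = x * (1 - p)"
    and gamma: "\<alpha> * b^2 - \<beta> * a^2 = x * (a + b - 2 / p)"
    and nz: "\<And>j. 1 \<le> j \<Longrightarrow> j \<le> m \<Longrightarrow> p ^ (2 * j) \<noteq> 1"
  shows "(\<Sum>k\<le>m. qfactorial a p k * qfactorial b p k * legendre_weight p k *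
            (\<alpha> * (1 - b * p ^ k) * (1 - b * p * p ^ k) - \<beta> * (1 - a * p ^ k) * (1 - a * p * p ^ k))) =
         qfactorial a p m * qfactorial b p m * legendre_weight p m *
            ((1 - a * p ^ m) * (1 - b * p ^ m) * (1 - p * (p ^ m)^2) * x / p ^ m)"
  using nz
proof (induction m)
  have cert: "(\<alpha> * (1 - b * K) * (1 - b * p * K) - \<beta> * (1 - a * K) * (1 - a * p * K)) * K =
      x * ((1 - a * K) * (1 - b * K) * (1 - p * K^2) - (1 - K)^2 * (1 - K^2))" for K
  proof -
    have a1: "\<alpha> = \<beta> + x * (2 - (a + b))" using alpha by (simp add: algebra_simps)
    have g: "p * (\<alpha> * b^2 - \<beta> * a^2) = x * (p * (a + b) - 2)"
      using gamma p0 by (simp add: field_simps)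
    show ?thesis using ab alpha beta g by algebra
  qed
  {
    case 0
    show ?case using cert[of 1] by (simp add: qfactorial_0 legendre_weight_def)
  next
    case (Suc m)
    define K where "K = p ^ m"
    have K0: "K \<noteq> 0" using p0 by (simp add: K_def)
    have n2: "p ^ (2 * Suc m) \<noteq> 1" using Suc.prems[of "Suc m"] by simp
    have n1: "p ^ Suc m \<noteq> 1"
    proof
      assume "p ^ Suc m = 1"
      then have "(p ^ Suc m) ^ 2 = 1" by simp
      then have "p ^ (2 * Suc m) = 1" by (simp only: power_mult [symmetric] mult.commute)
      then show False using n2 by simp
    qed
    define C where "C = qfactorial a p m * qfactorial b p m"
    define W where "W = legendre_weight p m"
    define W' where "W' = legendre_weight p (Suc m)"
    define AB where "AB = (1 - a * K) * (1 - b * K)"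
    have W: "W' * ((1 - p * K)^2 * (1 - p^2 * K^2)) = W * (1 - p * K^2) * p"
      unfolding W_def W'_def K_def using legendre_weight_Suc[OF n1 n2] .
    have IH: "(\<Sum>k\<le>m. qfactorial a p k * qfactorial b p k * legendre_weight p k *
            (\<alpha> * (1 - b * p ^ k) * (1 - b * p * p ^ k) - \<beta> * (1 - a * p ^ k) * (1 - a * p * p ^ k))) =
         C * W * (AB * (1 - p * K^2) * x / K)"
      unfolding C_def W_def AB_def K_def using Suc by simp
    have pK: "p ^ Suc m = p * K" by (simp add: K_def)
    have split: "C * W * (AB * (1 - p * K^2) * x / K) = C * AB * W' * ((1 - p * K)^2 * (1 - p^2 * K^2)) * x / (p * K)"
    proof -
      have W1: "W * (1 - p * K^2) = W' * ((1 - p * K)^2 * (1 - p^2 * K^2)) / p"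
        using W p0 by (simp add: divide_simps)
      have "C * W * (AB * (1 - p * K^2) * x / K) = C * AB * (W * (1 - p * K^2)) * x / K"
        by simp
      then show ?thesis unfolding W1 by simp
    qed
    define P where "P = \<alpha> * (1 - b * (p * K)) * (1 - b * p * (p * K)) - \<beta> * (1 - a * (p * K)) * (1 - a * p * (p * K))"
    have P: "P = x * ((1 - a * (p * K)) * (1 - b * (p * K)) * (1 - p * (p * K)^2) - (1 - p * K)^2 * (1 - (p * K)^2)) / (p * K)"
      using cert[of "p * K"] p0 K0 unfolding P_def by (simp add: field_simps)
    show ?case
      unfolding sum.atMost_Suc IH split pK qfactorial_Suc
      unfolding K_def[symmetric] W'_def[symmetric] P_def[symmetric] P C_def AB_def
      using p0 K0 by (simp add: divide_simps) (simp add: algebra_simps power_mult_distrib)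
  }
qed

text \<open>
  Choosing \<open>m = N + 2\<close> in \<open>gosper_telescoping\<close> makes the boundary term vanish, since \<open>a p^m = 1\<close>.
\<close>

lemma legendre_sum_rec:
  fixes p :: "'a::field"
  assumes p0: "p \<noteq> 0" and nz: "\<And>j. 1 \<le> j \<Longrightarrow> j \<le> N + 2 \<Longrightarrow> p ^ (2 * j) \<noteq> 1"
  shows "(1 - p ^ (N + 2))^2 * legendre_sum p (N + 2) = p * (1 - p ^ (N + 1))^2 * legendre_sum p N"
proof -
  define y where "y = p ^ N"
  have y0: "y \<noteq> 0" using p0 by (simp add: y_def)
  define a where "a = inverse (y * p^2)"
  define b where "b = y * p"
  \<comment> \<open>a solution of the three coefficient equations for these \<open>a\<close> and \<open>b\<close>\<close>
  define \<alpha> where "\<alpha> = (1 - y * p^2)^2"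
  define \<beta> where "\<beta> = y^2 * p^4 * (1 - y * p)^2"
  define x where "x = - (1 - y^2 * p^3) * (y * p^2)"
  have aN: "a = inverse (p ^ (N + 2))" by (simp add: a_def y_def power_add power2_eq_square mult_ac)
  have "p ^ j \<noteq> 1" if "1 \<le> j" "j \<le> N + 2" for j
    using nz[OF that] by (metis mult.commute power_mult power_one)
  from this[of "N+1"] this[of "N+2"]
  have n1: "1 - y * p \<noteq> 0" and n2: "1 - y * p^2 \<noteq> 0"
    by (auto simp: y_def mult_ac power_add power2_eq_square)
  have tel: "(\<Sum>k\<le>N+2. qfactorial a p k * qfactorial b p k * legendre_weight p k *
            (\<alpha> * (1 - b * p ^ k) * (1 - b * p * p ^ k) - \<beta> * (1 - a * p ^ k) * (1 - a * p * p ^ k))) = 0"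
  proof (subst gosper_telescoping[where x = x])
    show "a * b * p = 1" using p0 y0 unfolding a_def b_def by (simp add: field_simps power2_eq_square)
    show "\<alpha> - \<beta> = x * (2 - (a + b))" using p0 y0
      unfolding \<alpha>_def \<beta>_def x_def a_def b_def by (simp add: field_simps) algebra
    show "p * (\<beta> * a - \<alpha> * b) = x * (1 - p)" using p0 y0
      unfolding \<alpha>_def \<beta>_def x_def a_def b_def by (simp add: field_simps) algebra
    show "\<alpha> * b^2 - \<beta> * a^2 = x * (a + b - 2 / p)" using p0 y0
      unfolding \<alpha>_def \<beta>_def x_def a_def b_def by (simp add: field_simps) algebra
    show "qfactorial a p (N+2) * qfactorial b p (N+2) * legendre_weight p (N+2) *
            ((1 - a * p ^ (N+2)) * (1 - b * p ^ (N+2)) * (1 - p * (p ^ (N+2))^2) * x / p ^ (N+2)) = 0"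
    proof -
      have "a * p ^ (N+2) = 1" unfolding aN using p0 by (intro left_inverse) simp
      then show ?thesis by (simp only: diff_self mult_zero_left mult_zero_right div_0)
    qed
  qed (use p0 nz in auto)
  \<comment> \<open>both summands expressed through the common term of the telescoping\<close>
  have upper: "(1 - b) * (1 - b * p) * qfactorial (p ^ Suc (N + 2)) p k =
      qfactorial b p k * (1 - b * p ^ k) * (1 - b * p * p ^ k)" for k
  proof -
    have "p ^ Suc (N + 2) = b * p * p" by (simp add: b_def y_def power_add mult_ac)
    then have "(1 - b) * (1 - b * p) * qfactorial (p ^ Suc (N + 2)) p k = qfactorial b p (Suc (Suc k))"
      by (simp only: qfactorial_Suc_shift mult.assoc)
    then show ?thesis by (simp add: qfactorial_Suc mult_ac)
  qed
  have lower: "(1 - a) * (1 - a * p) * qfactorial (inverse y) p k =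
      qfactorial a p k * (1 - a * p ^ k) * (1 - a * p * p ^ k)" for k
  proof -
    have "inverse y = a * p * p" using p0 y0 by (simp add: a_def field_simps power2_eq_square)
    then have "(1 - a) * (1 - a * p) * qfactorial (inverse y) p k = qfactorial a p (Suc (Suc k))"
      by (simp only: qfactorial_Suc_shift mult.assoc)
    then show ?thesis by (simp add: qfactorial_Suc mult_ac)
  qed
  \<comment> \<open>two vanishing terms are added so that both sums have the same range\<close>
  have L: "legendre_sum p N = (\<Sum>k\<le>N+2. qfactorial (inverse y) p k * qfactorial b p k * legendre_weight p k)"
    unfolding legendre_sum_def y_def b_def
    by (rule sum.mono_neutral_cong_left) (auto simp: qfactorial_inverse_power_eq_0 p0 mult_ac)
  have L2: "legendre_sum p (N+2) = (\<Sum>k\<le>N+2. qfactorial a p k * qfactorial (p ^ Suc (N + 2)) p k * legendre_weight p k)"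
    unfolding legendre_sum_def aN ..
  have "0 = (\<Sum>k\<le>N+2. \<alpha> * (1 - b) * (1 - b * p) * (qfactorial a p k * qfactorial (p ^ Suc (N + 2)) p k * legendre_weight p k) -
     \<beta> * (1 - a) * (1 - a * p) * (qfactorial (inverse y) p k * qfactorial b p k * legendre_weight p k))"
    unfolding tel[symmetric]
  proof (rule sum.cong[OF refl], goal_cases)
    case (1 k)
    have "\<alpha> * (1 - b) * (1 - b * p) * (qfactorial a p k * qfactorial (p ^ Suc (N + 2)) p k * legendre_weight p k) =
        \<alpha> * (qfactorial a p k * legendre_weight p k) * ((1 - b) * (1 - b * p) * qfactorial (p ^ Suc (N + 2)) p k)"
      by (simp only: mult_ac)
    moreover have "\<beta> * (1 - a) * (1 - a * p) * (qfactorial (inverse y) p k * qfactorial b p k * legendre_weight p k) =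
        \<beta> * (qfactorial b p k * legendre_weight p k) * ((1 - a) * (1 - a * p) * qfactorial (inverse y) p k)"
      by (simp only: mult_ac)
    ultimately show ?case unfolding upper lower by (simp only: right_diff_distrib mult_ac)
  qed
  also have "\<dots> = \<alpha> * (1 - b) * (1 - b * p) * legendre_sum p (N+2) - \<beta> * (1 - a) * (1 - a * p) * legendre_sum p N"
    unfolding L L2 by (simp only: sum_subtractf sum_distrib_left)
  finally have 1: "\<alpha> * (1 - b) * (1 - b * p) * legendre_sum p (N+2) = \<beta> * (1 - a) * (1 - a * p) * legendre_sum p N"
    by simp
  have 2: "\<beta> * (1 - a) * (1 - a * p) = (1 - y * p) * (1 - y * p^2) * (p * (1 - y * p)^2)"
    using p0 y0 unfolding \<beta>_def a_def by (simp add: field_simps) algebra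
  have 3: "\<alpha> * (1 - b) * (1 - b * p) = (1 - y * p) * (1 - y * p^2) * (1 - y * p^2)^2"
    unfolding \<alpha>_def b_def by (simp add: power2_eq_square mult_ac)
  have "(1 - y * p^2)^2 * legendre_sum p (N+2) = p * (1 - y * p)^2 * legendre_sum p N"
    using 1 n1 n2 unfolding 2 3 by (simp add: mult.assoc)
  then show ?thesis by (simp add: y_def power_add mult.assoc mult.commute power2_eq_square)
qed

lemma legendre_sum_odd:
  fixes p :: "'a::field"
  assumes p0: "p \<noteq> 0" and nz: "\<And>j. 1 \<le> j \<Longrightarrow> j \<le> 2 * J + 1 \<Longrightarrow> p ^ (2 * j) \<noteq> 1"
  shows "legendre_sum p (2 * J + 1) = 0"
  using nz
proof (induction J)
  case 0
  have n2: "p^2 \<noteq> 1" using 0[of 1] by simp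
  then have n1: "p \<noteq> 1" by auto
  have "1 + (1 - inverse p) * (1 - p * p) * ((1 - p) * p) / ((1 - p)^2 * (1 - p^2)) = 0"
    using n1 n2 p0 by (simp add: divide_simps) (simp add: algebra_simps power2_eq_square)
  then show ?case
    by (simp add: legendre_sum_def legendre_weight_def qfactorial_def)
next
  case (Suc J)
  have "legendre_sum p (2 * J + 1) = 0" using Suc by simp
  then have "(1 - p ^ (2 * J + 1 + 2))^2 * legendre_sum p (2 * J + 1 + 2) = 0"
    using legendre_sum_rec[of p "2 * J + 1"] p0 Suc.prems by simp
  moreover have "p ^ (2 * J + 1 + 2) \<noteq> 1"
  proof
    assume "p ^ (2 * J + 1 + 2) = 1"
    moreover have "2 * J + 3 = 2 * J + 1 + 2" by simp
    ultimately have "(p ^ (2 * J + 3)) ^ 2 = 1" by (simp only: power_one)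
    then have "p ^ (2 * (2 * J + 3)) = 1" by (subst mult.commute) (simp only: power_mult)
    then show False using Suc.prems[of "2 * J + 3"] by simp
  qed
  ultimately show ?case by simp
qed

lemma legendre_sum_even:
  fixes p :: "'a::field"
  assumes p0: "p \<noteq> 0" and nz: "\<And>j. 1 \<le> j \<Longrightarrow> j \<le> 2 * J \<Longrightarrow> p ^ (2 * j) \<noteq> 1"
  shows "legendre_sum p (2 * J) = p ^ J * (qfactorial p (p^2) J / qfactorial (p^2) (p^2) J)^2"
  using nz
proof (induction J)
  case 0
  show ?case by (simp add: legendre_sum_def legendre_weight_def qfactorial_0)
next
  case (Suc J)
  let ?y = "(p^2) ^ J"
  have IH: "legendre_sum p (2 * J) = p ^ J * (qfactorial p (p^2) J / qfactorial (p^2) (p^2) J)^2"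
    using Suc by simp
  have "p ^ (2 * (2 * J + 2)) \<noteq> 1" using Suc.prems[of "2 * J + 2"] by simp
  then have "p ^ (2 * J + 2) \<noteq> 1" by (metis mult.commute power_mult power_one)
  moreover have e2: "p ^ (2 * J + 2) = p^2 * ?y" by (simp add: power_add power_mult power2_eq_square)
  moreover have e1: "p ^ (2 * J + 1) = p * ?y" by (simp add: power_mult)
  ultimately have n: "1 - p^2 * ?y \<noteq> 0" by simp
  have "(1 - p^2 * ?y)^2 * legendre_sum p (2 * J + 2) = p * (1 - p * ?y)^2 * legendre_sum p (2 * J)"
    using legendre_sum_rec[of p "2 * J"] p0 Suc.prems unfolding e1 e2 by simp
  then have "legendre_sum p (2 * J + 2) = p * ((1 - p * ?y) / (1 - p^2 * ?y))^2 * legendre_sum p (2 * J)"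
    using n by (simp add: field_simps)
  then show ?case unfolding IH
    by (simp add: qfactorial_Suc power_mult_distrib power_divide mult_ac)
qed

section \<open>The deformation of the sum\<close>

text \<open>
  The product \<open>(1 - a q^j) (1 - q^j / a)\<close> as a polynomial in \<open>u = a + 1/a\<close>.
\<close>

definition quad :: "'a::comm_ring_1 \<Rightarrow> nat \<Rightarrow> 'a poly" where
  "quad q j = [:1 + q ^ (2 * j), - (q ^ j):]"

definition odd_prod :: "'a::comm_ring_1 \<Rightarrow> nat \<Rightarrow> 'a poly" where
  "odd_prod q k = (\<Prod>j<k. quad q (2 * j + 1))"

definition deformed_sum :: "'a::field \<Rightarrow> nat \<Rightarrow> 'a poly" where
  "deformed_sum q H = (\<Sum>k\<le>H. smult (legendre_weight (q^2) k) (odd_prod q k))"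

text \<open>
  The value of \<open>u = a + 1/a\<close> for \<open>a = q^(2N+1)\<close>, where the factor \<open>(q/a;q\<^sup>2)\<^sub>k\<close> vanishes for all \<open>k > N\<close>.
\<close>

definition node :: "'a::field \<Rightarrow> nat \<Rightarrow> 'a" where
  "node q N = q ^ (2 * N + 1) + inverse (q ^ (2 * N + 1))"

lemma poly_quad: "poly (quad q j) u = 1 - u * q ^ j + q ^ (2 * j)"
  by (simp add: quad_def algebra_simps)

lemma poly_quad_2: "poly (quad q j) 2 = (1 - q ^ j)^2"
  by (simp add: poly_quad power2_diff power_even_eq)

lemma poly_quad_node:
  fixes A :: "'a::field"
  assumes "A \<noteq> 0"
  shows "poly (quad q j) (A + inverse A) = (1 - A * q ^ j) * (1 - inverse A * q ^ j)"
proof -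
  have "q ^ (2 * j) = q ^ j * q ^ j" by (simp add: mult_2 power_add)
  with assms show ?thesis by (simp add: poly_quad field_simps)
qed

lemma poly_odd_prod_2: "poly (odd_prod q k) 2 = qfactorial q (q^2) k ^ 2"
  by (simp add: odd_prod_def poly_prod poly_quad_2 qfactorial_def prod_power_distrib power_mult)

lemma poly_odd_prod_node:
  fixes q :: "'a::field"
  assumes "q \<noteq> 0"
  shows "poly (odd_prod q k) (node q N) =
    qfactorial (inverse ((q^2) ^ N)) (q^2) k * qfactorial ((q^2) ^ Suc N) (q^2) k"
  unfolding odd_prod_def poly_prod qfactorial_def prod.distrib [symmetric]
proof (rule prod.cong[OF refl])
  fix j
  have odd: "q ^ (2 * i + 1) = (q^2) ^ i * q" for i
    by (simp add: power_mult)
  have 1: "q ^ (2 * N + 1) * q ^ (2 * j + 1) = (q^2) ^ Suc N * (q^2) ^ j"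
    unfolding odd power_Suc power2_eq_square[of q] by (simp only: mult_ac)
  have 2: "inverse (q ^ (2 * N + 1)) * q ^ (2 * j + 1) = inverse ((q^2) ^ N) * (q^2) ^ j"
    unfolding odd using assms by simp
  show "poly (quad q (2 * j + 1)) (node q N) =
      (1 - inverse ((q^2) ^ N) * (q^2) ^ j) * (1 - (q^2) ^ Suc N * (q^2) ^ j)"
    unfolding node_def using assms by (subst poly_quad_node) (simp, simp only: 1 2 mult.commute[of "1 - inverse _ * _"])
qed

lemma poly_deformed_sum_node:
  fixes q :: "'a::field"
  assumes "q \<noteq> 0" "N \<le> H"
  shows "poly (deformed_sum q H) (node q N) = legendre_sum (q^2) N"
proof -
  have "legendre_sum (q^2) N = (\<Sum>k\<le>H. qfactorial (inverse ((q^2) ^ N)) (q^2) k *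
      qfactorial ((q^2) ^ Suc N) (q^2) k * legendre_weight (q^2) k)"
    unfolding legendre_sum_def using assms
    by (intro sum.mono_neutral_left) (auto simp: qfactorial_inverse_power_eq_0)
  then show ?thesis
    by (simp add: deformed_sum_def poly_sum poly_odd_prod_node[OF assms(1)] mult_ac)
qed

section \<open>The deformation at a primitive root of unity\<close>

definition even_prod :: "'a::comm_ring_1 \<Rightarrow> nat \<Rightarrow> 'a poly" where
  "even_prod q M = (\<Prod>i<M. quad q (4 * i + 2))"

lemma degree_quad: "degree (quad q j) \<le> 1"
  by (simp add: quad_def)

lemma degree_odd_prod: "degree (odd_prod q k) \<le> k"
  unfolding odd_prod_def
  by (rule order_trans[OF degree_prod_sum_le]) (auto intro!: order_trans[OF sum_mono[OF degree_quad]])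

lemma degree_even_prod: "degree (even_prod q k) \<le> k"
  unfolding even_prod_def
  by (rule order_trans[OF degree_prod_sum_le]) (auto intro!: order_trans[OF sum_mono[OF degree_quad]])

lemma degree_deformed_sum: "degree (deformed_sum q H) \<le> H"
  unfolding deformed_sum_def
  by (intro degree_sum_le) (auto intro: order_trans[OF degree_smult_le] order_trans[OF degree_odd_prod])

lemma poly_even_prod_node:
  fixes q :: "'a::field"
  assumes "q \<noteq> 0"
  shows "poly (even_prod q M) (node q N) =
    qfactorial (q ^ (2 * N + 3)) (q^4) M * qfactorial (inverse (q ^ (2 * N + 1)) * q^2) (q^4) M"
  unfolding even_prod_def poly_prod qfactorial_def prod.distrib [symmetric]
proof (rule prod.cong[OF refl])
  fix j
  have even: "q ^ (4 * j + 2) = q^2 * (q^4) ^ j"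
    unfolding power_add power_mult by (rule mult.commute)
  have "2 * N + 3 = (2 * N + 1) + 2" by simp
  then have odd: "q ^ (2 * N + 3) = q ^ (2 * N + 1) * q^2" by (simp only: power_add)
  have 1: "q ^ (2 * N + 1) * q ^ (4 * j + 2) = q ^ (2 * N + 3) * (q^4) ^ j"
    unfolding even odd by (simp only: mult.assoc)
  have 2: "inverse (q ^ (2 * N + 1)) * q ^ (4 * j + 2) = inverse (q ^ (2 * N + 1)) * q^2 * (q^4) ^ j"
    unfolding even by (simp only: mult.assoc)
  show "poly (quad q (4 * j + 2)) (node q N) =
      (1 - q ^ (2 * N + 3) * (q^4) ^ j) * (1 - inverse (q ^ (2 * N + 1)) * q^2 * (q^4) ^ j)"
    unfolding node_def using assms by (subst poly_quad_node) (simp, unfold 1 2, rule refl)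
qed

context
  fixes q :: "'a::field" and n M :: nat
  assumes n: "n = 4 * M + 1" and root: "\<And>j. q ^ j = 1 \<longleftrightarrow> n dvd j"
begin

lemma root_nonzero: "q \<noteq> 0"
proof
  assume "q = 0"
  moreover have "q ^ n = 1" using root by simp
  ultimately show False using n by simp
qed

lemma root_power_neq_1: "0 < j \<Longrightarrow> j < n \<Longrightarrow> q ^ j \<noteq> 1"
  using root by (auto dest: dvd_imp_le)

text \<open>
  The condition under which the denominators of the sum up to \<open>2 M\<close> do not vanish; here \<open>n\<close> is prime
  to \<open>4\<close>.
\<close>

lemma root_square_power_neq_1:
  assumes "1 \<le> j" "j \<le> 2 * M"
  shows "(q^2) ^ (2 * j) \<noteq> 1"
proof -
  have "coprime n (2 ^ 2)" using n by (subst coprime_power_right_iff) (simp add: coprime_right_2_iff_odd)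
  then have c: "coprime n 4" by simp
  have "\<not> n dvd 4 * j"
  proof
    assume "n dvd 4 * j"
    then have "n dvd j" using c by (simp add: coprime_dvd_mult_right_iff)
    then show False using assms n by (auto dest: dvd_imp_le)
  qed
  then show ?thesis using root[of "4 * j"] by (simp add: power_mult [symmetric])
qed

text \<open>
  Two nodes coincide iff their values \<open>a = q^(2N+1)\<close> are equal or inverse to each other. Either way \<open>n\<close>,
  being odd, would divide \<open>N' - N\<close> or \<open>N + N' + 1\<close>, and both are positive and less than \<open>n\<close>.
\<close>

lemma node_inj: "inj_on (node q) {..2 * M}"
proof (rule linorder_inj_onI')
  fix N N' assume N: "N \<in> {..2 * M}" "N' \<in> {..2 * M}" and less: "N < N'"
  have odd: "odd n" using n by simp
  define A where "A = q ^ (2 * N + 1)"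
  define B where "B = q ^ (2 * (N' - N))"
  have A0: "A \<noteq> 0" "B \<noteq> 0" using root_nonzero by (auto simp: A_def B_def)
  have "2 * N' + 1 = (2 * N + 1) + 2 * (N' - N)" using less by simp
  then have AB: "q ^ (2 * N' + 1) = A * B" by (simp only: A_def B_def power_add)
  show "node q N \<noteq> node q N'"
  proof
    assume "node q N = node q N'"
    then have "A + inverse A = A * B + inverse (A * B)" unfolding node_def AB A_def .
    then have "A * ((1 - B) * (1 - A * (A * B))) = 0" using A0 by (simp add: field_simps)
    with A0 consider "B = 1" | "A * (A * B) = 1" by auto
    then show False
    proof cases
      case 1
      then have "n dvd 2 * (N' - N)" using root B_def by simp
      then have "n dvd N' - N" using odd by (simp add: coprime_dvd_mult_right_iff coprime_right_2_iff_odd)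
      then show False using N less n by (auto dest: dvd_imp_le)
    next
      case 2
      have "A * (A * B) = q ^ (2 * N + 1 + (2 * N' + 1))" unfolding power_add[of _ "2*N+1"] AB A_def ..
      then have "q ^ (2 * N + 1 + (2 * N' + 1)) = 1" using 2 by (simp only:)
      then have "n dvd 2 * N + 1 + (2 * N' + 1)" by (rule root[THEN iffD1])
      also have "2 * N + 1 + (2 * N' + 1) = 2 * (N + N' + 1)" by simp
      finally have "n dvd N + N' + 1"
        using odd coprime_dvd_mult_right_iff coprime_right_2_iff_odd by blast
      then have "n \<le> N + N' + 1" by (rule dvd_imp_le) simp
      then show False using N less n by auto
    qed
  qed
qed

text \<open>
  The exponents \<open>4 J + 3\<close> and \<open>4 i + 2\<close> add up to \<open>n\<close> for \<open>i = M - J - 1\<close>, which gives a vanishing factor.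
\<close>

lemma even_prod_odd_node:
  assumes "J < M"
  shows "poly (even_prod q M) (node q (2 * J + 1)) = 0"
proof -
  have "q ^ (2 * (2 * J + 1) + 3) * (q^4) ^ (M - Suc J) = q ^ (2 * (2 * J + 1) + 3 + 4 * (M - Suc J))"
    by (simp only: power_add power_mult)
  also have "2 * (2 * J + 1) + 3 + 4 * (M - Suc J) = n" using assms n by simp
  finally have "q ^ (2 * (2 * J + 1) + 3) * (q^4) ^ (M - Suc J) = 1" using root by simp
  then have "qfactorial (q ^ (2 * (2 * J + 1) + 3)) (q^4) M = 0"
    unfolding qfactorial_def using assms by (intro prod_zero) (auto intro!: bexI[of _ "M - Suc J"])
  then show ?thesis using poly_even_prod_node[OF root_nonzero] by simp
qed

text \<open>
  At the node \<open>2 J\<close> the product splits into two \<open>q\<close>-factorials in base \<open>q\<^sup>4\<close>. Passing from \<open>J\<close> to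
  \<open>J + 1\<close> shifts each argument by one step of the base, so only end factors change; as \<open>q^(4M) = 1/q\<close>, the
  ratio is \<open>q (1 - q^(4J+2)) / (1 - q^(4J+4))\<close>. Its square is the ratio of consecutive values of
  \<open>legendre_sum\<close> at even arguments.
\<close>

lemma even_prod_even_node:
  assumes "J \<le> M"
  shows "poly (even_prod q M) (node q (2 * J)) * qfactorial (q^4) (q^4) J =
    poly (even_prod q M) (node q 0) * (q ^ J * qfactorial (q^2) (q^4) J)"
  using assms
proof (induction J)
  case 0
  show ?case by (simp add: qfactorial_0)
next
  case (Suc J)
  define y where "y = q ^ (4 * J)"
  define V where "V J = qfactorial (q ^ (4 * J + 3)) (q^4) M" for J
  define U where "U J = qfactorial (inverse (q ^ (4 * J + 1)) * q^2) (q^4) M" for J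
  have e: "poly (even_prod q M) (node q (2 * J)) = V J * U J" for J
    using poly_even_prod_node[OF root_nonzero, of M "2 * J"] by (simp add: U_def V_def)
  have q0: "q \<noteq> 0" using root_nonzero .
  have y0: "y \<noteq> 0" using q0 by (simp add: y_def)
  have "(q^4) ^ M * q = q ^ n" by (simp add: n power_mult)
  then have qM: "(q^4) ^ M = inverse q" using root[of n] q0 by (simp add: field_simps)
  have V: "V J * (1 - y * q^2) = (1 - y * q^3) * V (Suc J)"
  proof -
    have 1: "q ^ (4 * J + 3) * q ^ 4 = q ^ (4 * Suc J + 3)" by (simp flip: power_add)
    have 2: "q ^ (4 * J + 3) * inverse q = y * q^2"
      using q0 by (simp add: y_def power_add power2_eq_square power3_eq_cube)
    have 3: "q ^ (4 * J + 3) = y * q^3" by (simp add: y_def power_add)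
    have "V J * (1 - q ^ (4 * J + 3) * (q^4) ^ M) =
        (1 - q ^ (4 * J + 3)) * qfactorial (q ^ (4 * J + 3) * q^4) (q^4) M"
      unfolding V_def by (simp only: qfactorial_Suc [symmetric] qfactorial_Suc_shift)
    then show ?thesis unfolding qM 1 2 V_def [symmetric] unfolding 3 .
  qed
  have U: "U (Suc J) * (1 - inverse (y * q^4)) = (1 - inverse (y * q^3)) * U J"
  proof -
    have 0: "q ^ (4 * Suc J + 1) = y * q^3 * q^2" "q^4 = q^3 * q" "q ^ (4 * J + 1) = y * q"
      by (simp_all add: y_def flip: power_add power_Suc2)
    have 1: "inverse (q ^ (4 * Suc J + 1)) * q^2 = inverse (y * q^3)"
      unfolding 0 using q0 by simp
    have 2: "inverse (y * q^3) * q^4 = inverse (q ^ (4 * J + 1)) * q^2"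
      unfolding 0 using q0 y0 by (simp add: field_simps power2_eq_square)
    have 3: "inverse (y * q^3) * inverse q = inverse (y * q^4)"
      unfolding 0 by (simp add: mult_ac)
    show ?thesis
      using qfactorial_Suc[of "inverse (y * q^3)" "q^4" M] qfactorial_Suc_shift[of "inverse (y * q^3)" "q^4" M]
      unfolding U_def 1 2 3 qM by simp
  qed
  have n3: "y * q^3 \<noteq> 1"
    using root_power_neq_1[of "4 * J + 3"] Suc.prems n by (simp add: y_def power_add)
  \<comment> \<open>\<open>1 - q^(4J+3)\<close> occurs in both shifts and cancels\<close>
  have "(V (Suc J) * U (Suc J) * (1 - y * q^4)) * (1 - y * q^3) =
        (q * (V J * U J) * (1 - y * q^2)) * (1 - y * q^3)"
  proof -
    have "U (Suc J) * (y * q^4 - 1) = q * (y * q^3 - 1) * U J"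
    proof -
      define t where "t = y * q^3"
      have t0: "t \<noteq> 0" using y0 q0 by (simp add: t_def)
      have tq: "y * q^4 = t * q" by (simp add: t_def power3_eq_cube power4_eq_xxxx)
      have "U (Suc J) * (t * q - 1) = (U (Suc J) * (1 - inverse (t * q))) * (t * q)"
        using t0 q0 by (simp add: field_simps)
      also have "\<dots> = ((1 - inverse t) * U J) * (t * q)"
        using U unfolding tq t_def by simp
      also have "\<dots> = q * (t - 1) * U J"
        using t0 by (simp add: field_simps)
      finally show ?thesis unfolding tq t_def .
    qed
    with V show ?thesis by algebra
  qed
  then have 1: "V (Suc J) * U (Suc J) * (1 - y * q^4) = q * (V J * U J) * (1 - y * q^2)"
    using n3 by simp
  have IH: "V J * U J * qfactorial (q^4) (q^4) J = V 0 * U 0 * (q ^ J * qfactorial (q^2) (q^4) J)"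
    using Suc e[of 0] by (simp add: e)
  have y: "(q^4) ^ J = y" by (simp add: y_def power_mult)
  have "V (Suc J) * U (Suc J) * (qfactorial (q^4) (q^4) J * (1 - q^4 * y)) =
      V (Suc J) * U (Suc J) * (1 - y * q^4) * qfactorial (q^4) (q^4) J"
    by (simp only: mult_ac)
  also have "\<dots> = V J * U J * qfactorial (q^4) (q^4) J * (q * (1 - y * q^2))"
    unfolding 1 by (simp only: mult_ac)
  also have "\<dots> = V 0 * U 0 * (q * q ^ J * (qfactorial (q^2) (q^4) J * (1 - q^2 * y)))"
    unfolding IH by (simp only: mult_ac)
  finally show ?case
    using e[of 0] unfolding e[of "Suc J"] qfactorial_Suc y power_Suc by simp
qed

text \<open>
  Interpolation at the \<open>2 M + 1\<close> nodes. The constant is fixed by the node \<open>0\<close>, where the sum is \<open>1\<close>.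
\<close>

lemma deformed_sum_at_root:
  "smult (poly (even_prod q M) (node q 0) ^ 2) (deformed_sum q (2 * M)) = even_prod q M ^ 2"
    (is "smult ?c _ = _")
proof (rule poly_eqI_degree[where A = "node q ` {..2 * M}"])
  have card: "card (node q ` {..2 * M}) = 2 * M + 1"
    using node_inj by (simp add: card_image)
  show "degree (smult ?c (deformed_sum q (2 * M))) < card (node q ` {..2 * M})"
    unfolding card using order_trans[OF degree_smult_le degree_deformed_sum[of q "2 * M"]]
    by (meson less_add_one order_le_less_trans)
  have "degree (even_prod q M ^ 2) \<le> degree (even_prod q M) * 2"
    by (rule degree_power_le)
  also have "\<dots> \<le> M * 2" using degree_even_prod[of q M] by simp
  finally show "degree (even_prod q M ^ 2) < card (node q ` {..2 * M})"
    unfolding card by simp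
  fix u assume "u \<in> node q ` {..2 * M}"
  then obtain N where N: "N \<le> 2 * M" "u = node q N" by auto
  have S: "poly (deformed_sum q (2 * M)) u = legendre_sum (q^2) N"
    using N poly_deformed_sum_node[OF root_nonzero] by simp
  have q0: "q^2 \<noteq> 0" using root_nonzero by simp
  show "poly (smult ?c (deformed_sum q (2 * M))) u = poly (even_prod q M ^ 2) u"
  proof (cases "even N")
    case False
    then obtain J where J: "N = 2 * J + 1" by (auto elim: oddE)
    have "legendre_sum (q^2) (2 * J + 1) = 0"
      by (rule legendre_sum_odd[OF q0]) (use root_square_power_neq_1 N J in auto)
    moreover have "poly (even_prod q M) (node q (2 * J + 1)) = 0"
      using even_prod_odd_node N J by simp
    ultimately show ?thesis using S N J by simp
  next
    case True
    then obtain J where J: "N = 2 * J" by auto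
    let ?d = "qfactorial (q^4) (q^4) J"
    have q4: "(q^2)^2 = q^4" by (simp flip: power_mult)
    have "legendre_sum (q^2) N = (q^2) ^ J * (qfactorial (q^2) (q^4) J / ?d)^2"
      unfolding J q4[symmetric]
      by (rule legendre_sum_even[OF q0]) (use root_square_power_neq_1 N J in auto)
    also have "(q^2) ^ J = (q ^ J)^2" by (simp add: power_mult [symmetric] mult.commute)
    finally have L: "legendre_sum (q^2) N = (q ^ J * qfactorial (q^2) (q^4) J / ?d)^2"
      by (simp add: power_mult_distrib power_divide)
    have "?d \<noteq> 0"
    proof (rule qfactorial_nonzero)
      fix j assume "j < J"
      then have "(q^2) ^ (2 * Suc j) \<noteq> 1" using N J by (intro root_square_power_neq_1) auto
      then show "q^4 * (q^4) ^ j \<noteq> 1" unfolding power_mult q4 by simp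
    qed
    then have "poly (even_prod q M) u =
        poly (even_prod q M) (node q 0) * (q ^ J * qfactorial (q^2) (q^4) J / ?d)"
      using even_prod_even_node[of J] N J by (simp add: field_simps)
    then show ?thesis using S L by (simp add: power_mult_distrib power_divide)
  qed
qed

lemma even_prod_node_0_nonzero: "poly (even_prod q M) (node q 0) \<noteq> 0"
proof -
  have "poly (quad q (4 * i + 2)) (node q 0) \<noteq> 0" if "i < M" for i
  proof -
    have "q * q ^ (4 * i + 2) \<noteq> 1"
      using root_power_neq_1[of "4 * i + 3"] that n by (simp add: numeral_3_eq_3)
    moreover have "inverse q * q ^ (4 * i + 2) = q ^ (4 * i + 1)" using root_nonzero by simp
    moreover have "q ^ (4 * i + 1) \<noteq> 1"
      using root_power_neq_1[of "4 * i + 1"] that n by simp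
    moreover have "node q 0 = q + inverse q" by (simp add: node_def)
    ultimately show ?thesis using poly_quad_node[OF root_nonzero, of q "4*i+2"] 
      by (metis mult_eq_0_iff right_minus_eq)
  qed
  then show ?thesis by (simp add: even_prod_def poly_prod)
qed

text \<open>
  The square doubles the logarithmic derivative of the product, which explains the factor \<open>2\<close> in the
  congruence.
\<close>

lemma log_derivative_at_root:
  "poly (pderiv (deformed_sum q (2 * M))) 2 =
     - 2 * poly (deformed_sum q (2 * M)) 2 * (\<Sum>i<M. q ^ (4 * i + 2) / (1 - q ^ (4 * i + 2))^2)"
proof -
  let ?P = "even_prod q M" and ?c = "poly (even_prod q M) (node q 0) ^ 2"
  let ?T = "\<Sum>i<M. q ^ (4 * i + 2) / (1 - q ^ (4 * i + 2))^2"
  have P': "poly (pderiv ?P) 2 = - ?T * poly ?P 2"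
  proof -
    have deriv_term: "poly (prod (\<lambda>i. quad q (4 * i + 2)) ({..<M} - {i})) 2 * poly (pderiv (quad q (4 * i + 2))) 2 =
        poly ?P 2 * - (q ^ (4 * i + 2) / (1 - q ^ (4 * i + 2))^2)" if "i < M" for i
    proof -
      have "q ^ (4 * i + 2) \<noteq> 1" using root_power_neq_1[of "4*i+2"] that n by simp
      moreover have "poly ?P 2 = (1 - q ^ (4 * i + 2))^2 * poly (prod (\<lambda>i. quad q (4 * i + 2)) ({..<M} - {i})) 2"
        unfolding even_prod_def using that
        by (subst prod.remove[of "{..<M}" i]) (auto simp: poly_quad_2)
      moreover have "pderiv (quad q (4 * i + 2)) = [:- (q ^ (4 * i + 2)):]"
        by (simp add: quad_def pderiv_pCons)
      ultimately show ?thesis by simp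
    qed
    have "poly (pderiv ?P) 2 = (\<Sum>i<M. poly (prod (\<lambda>i. quad q (4 * i + 2)) ({..<M} - {i})) 2 *
        poly (pderiv (quad q (4 * i + 2))) 2)"
      by (simp only: even_prod_def pderiv_prod poly_sum poly_mult)
    also have "\<dots> = (\<Sum>i<M. poly ?P 2 * - (q ^ (4 * i + 2) / (1 - q ^ (4 * i + 2))^2))"
      by (rule sum.cong) (auto simp only: deriv_term lessThan_iff)
    also have "\<dots> = - ?T * poly ?P 2"
      by (simp only: sum_negf mult_minus_right mult_minus_left sum_distrib_left mult.commute)
    finally show ?thesis .
  qed
  have c: "?c \<noteq> 0" using even_prod_node_0_nonzero by simp
  have "?c * poly (pderiv (deformed_sum q (2 * M))) 2 = poly (pderiv (?P ^ 2)) 2"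
    unfolding deformed_sum_at_root[symmetric] by (simp add: pderiv_smult)
  also have "\<dots> = - 2 * ?T * poly (?P ^ 2) 2"
    by (simp add: power2_eq_square pderiv_mult P')
  also have "poly (?P ^ 2) 2 = ?c * poly (deformed_sum q (2 * M)) 2"
    unfolding deformed_sum_at_root[symmetric] by simp
  finally have "?c * poly (pderiv (deformed_sum q (2 * M))) 2 =
      ?c * (- 2 * poly (deformed_sum q (2 * M)) 2 * ?T)"
    by (simp only: mult_ac)
  then show ?thesis by (rule mult_left_cancel[OF c, THEN iffD1])
qed

end

section \<open>Difference quotients of the deformation\<close>

text \<open>
  The difference quotient in \<open>u\<close> is written without a division, so that it still makes sense at
  \<open>u = v\<close>, where it is the derivative. The recursion is the product rule for differences.
\<close>

primrec odd_prod_quotient :: "'a::comm_ring_1 \<Rightarrow> 'a \<Rightarrow> 'a \<Rightarrow> nat \<Rightarrow> 'a" where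
  "odd_prod_quotient q u v 0 = 0"
| "odd_prod_quotient q u v (Suc k) =
     odd_prod_quotient q u v k * poly (quad q (2 * k + 1)) u - q ^ (2 * k + 1) * poly (odd_prod q k) v"

definition deformed_sum_quotient :: "'a::field \<Rightarrow> nat \<Rightarrow> 'a \<Rightarrow> 'a \<Rightarrow> 'a" where
  "deformed_sum_quotient q H u v = (\<Sum>k\<le>H. legendre_weight (q^2) k * odd_prod_quotient q u v k)"

lemma odd_prod_Suc: "odd_prod q (Suc k) = odd_prod q k * quad q (2 * k + 1)"
  by (simp add: odd_prod_def)

lemma odd_prod_diff:
  "poly (odd_prod q k) u - poly (odd_prod q k) v = (u - v) * odd_prod_quotient q u v k"
proof (induction k)
  case 0
  show ?case by (simp add: odd_prod_def)
next
  case (Suc k)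
  have "poly (quad q (2 * k + 1)) v = poly (quad q (2 * k + 1)) u + (u - v) * q ^ (2 * k + 1)"
    by (simp add: poly_quad algebra_simps)
  then have "poly (odd_prod q (Suc k)) u - poly (odd_prod q (Suc k)) v =
      (poly (odd_prod q k) u - poly (odd_prod q k) v) * poly (quad q (2 * k + 1)) u
        - (u - v) * (q ^ (2 * k + 1) * poly (odd_prod q k) v)"
    unfolding odd_prod_Suc poly_mult by (simp only:) (simp only: algebra_simps)
  then show ?case unfolding Suc.IH odd_prod_quotient.simps
    by (simp only: right_diff_distrib mult.assoc)
qed

lemma odd_prod_quotient_diagonal:
  fixes q :: "'a::idom"
  shows "odd_prod_quotient q u u k = poly (pderiv (odd_prod q k)) u"
proof (induction k)
  case (Suc k)
  have "pderiv (quad q (2 * k + 1)) = [:- (q ^ (2 * k + 1)):]"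
    by (simp add: quad_def pderiv_pCons)
  then show ?case
    unfolding odd_prod_Suc pderiv_mult odd_prod_quotient.simps Suc.IH poly_add poly_mult
    by (simp only: poly_pCons poly_0) (simp add: mult_ac)
qed (simp add: odd_prod_def pderiv_1)

lemma deformed_sum_diff:
  "poly (deformed_sum q H) u - poly (deformed_sum q H) v = (u - v) * deformed_sum_quotient q H u v"
  unfolding deformed_sum_def deformed_sum_quotient_def poly_sum poly_smult
    sum_subtractf [symmetric] right_diff_distrib [symmetric] odd_prod_diff sum_distrib_left
  by (simp only: mult.left_commute)

lemma deformed_sum_quotient_diagonal:
  "deformed_sum_quotient q H u u = poly (pderiv (deformed_sum q H)) u"
proof (induction H)
  case (Suc H)
  have "deformed_sum q (Suc H) = deformed_sum q H + smult (legendre_weight (q^2) (Suc H)) (odd_prod q (Suc H))"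
    by (simp add: deformed_sum_def)
  then show ?case
    using Suc.IH
    by (simp add: deformed_sum_quotient_def pderiv_add pderiv_smult flip: odd_prod_quotient_diagonal)
qed (simp add: deformed_sum_def deformed_sum_quotient_def odd_prod_def pderiv_smult)

section \<open>Specialization of rational functions and cyclotomic divisibility\<close>

text \<open>
  Evaluation of rational functions at \<open>z\<close> as a relation: it holds only for those \<open>f\<close> that are regular at
  \<open>z\<close>, and is thus compatible with all field operations, division being restricted to nonzero values.
\<close>

definition specializes_to :: "complex \<Rightarrow> rat poly fract \<Rightarrow> complex \<Rightarrow> bool" where
  "specializes_to z f v \<longleftrightarrow> (\<exists>a b. f = to_fract a / to_fract b \<and> poly (cpoly b) z \<noteq> 0 \<and>
     v = poly (cpoly a) z / poly (cpoly b) z)"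

lemma specializes_toI:
  "f = to_fract a / to_fract b \<Longrightarrow> poly (cpoly b) z \<noteq> 0 \<Longrightarrow> v = poly (cpoly a) z / poly (cpoly b) z
    \<Longrightarrow> specializes_to z f v"
  unfolding specializes_to_def by blast

lemma specializes_toE:
  assumes "specializes_to z f v"
  obtains a b where "f = to_fract a / to_fract b" "b \<noteq> 0" "poly (cpoly b) z \<noteq> 0"
    "v = poly (cpoly a) z / poly (cpoly b) z"
  using assms unfolding specializes_to_def by fastforce

lemma cpoly_diff: "cpoly (p - r) = cpoly p - cpoly r"
  by (rule poly_eqI) (simp add: coeff_cpoly of_rat_diff)

lemma specializes_to_polynomial: "specializes_to z (to_fract a) (poly (cpoly a) z)"
  by (rule specializes_toI[where a = a and b = 1]) (simp_all only: cpoly_1 to_fract_1, simp_all)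

lemma specializes_to_0: "specializes_to z 0 0"
  using specializes_to_polynomial[of z 0] by simp

lemma specializes_to_1: "specializes_to z 1 1"
  using specializes_to_polynomial[of z 1] by (simp only: to_fract_1 cpoly_1 poly_1)

lemma specializes_to_qvar: "specializes_to z qvar z"
  using specializes_to_polynomial[of z "[:0, 1:]"] by (simp add: qvar_def map_poly_pCons)

lemma specializes_to_add:
  assumes "specializes_to z f v" "specializes_to z g w"
  shows "specializes_to z (f + g) (v + w)"
proof -
  obtain a b where f: "f = to_fract a / to_fract b" "b \<noteq> 0" "poly (cpoly b) z \<noteq> 0"
    "v = poly (cpoly a) z / poly (cpoly b) z" using assms(1) by (rule specializes_toE)
  obtain c d where g: "g = to_fract c / to_fract d" "d \<noteq> 0" "poly (cpoly d) z \<noteq> 0"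
    "w = poly (cpoly c) z / poly (cpoly d) z" using assms(2) by (rule specializes_toE)
  show ?thesis
    by (rule specializes_toI[where a = "a * d + c * b" and b = "b * d"])
      (use f g in \<open>simp_all add: cpoly_add cpoly_mult add_frac_eq\<close>)
qed

lemma specializes_to_diff:
  assumes "specializes_to z f v" "specializes_to z g w"
  shows "specializes_to z (f - g) (v - w)"
proof -
  obtain a b where f: "f = to_fract a / to_fract b" "b \<noteq> 0" "poly (cpoly b) z \<noteq> 0"
    "v = poly (cpoly a) z / poly (cpoly b) z" using assms(1) by (rule specializes_toE)
  obtain c d where g: "g = to_fract c / to_fract d" "d \<noteq> 0" "poly (cpoly d) z \<noteq> 0"
    "w = poly (cpoly c) z / poly (cpoly d) z" using assms(2) by (rule specializes_toE)
  show ?thesis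
    by (rule specializes_toI[where a = "a * d - c * b" and b = "b * d"])
      (use f g in \<open>simp_all add: cpoly_diff cpoly_mult diff_frac_eq\<close>)
qed

lemma specializes_to_mult:
  assumes "specializes_to z f v" "specializes_to z g w"
  shows "specializes_to z (f * g) (v * w)"
proof -
  obtain a b where f: "f = to_fract a / to_fract b" "b \<noteq> 0" "poly (cpoly b) z \<noteq> 0"
    "v = poly (cpoly a) z / poly (cpoly b) z" using assms(1) by (rule specializes_toE)
  obtain c d where g: "g = to_fract c / to_fract d" "d \<noteq> 0" "poly (cpoly d) z \<noteq> 0"
    "w = poly (cpoly c) z / poly (cpoly d) z" using assms(2) by (rule specializes_toE)
  show ?thesis
    by (rule specializes_toI[where a = "a * c" and b = "b * d"])
      (use f g in \<open>simp_all add: cpoly_mult\<close>)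
qed

lemma specializes_to_inverse:
  assumes "specializes_to z f v" "v \<noteq> 0"
  shows "specializes_to z (inverse f) (inverse v)"
proof -
  obtain a b where f: "f = to_fract a / to_fract b" "b \<noteq> 0" "poly (cpoly b) z \<noteq> 0"
    "v = poly (cpoly a) z / poly (cpoly b) z" using assms(1) by (rule specializes_toE)
  show ?thesis
    by (rule specializes_toI[where a = b and b = a]) (use f assms(2) in \<open>simp_all\<close>)
qed

lemma specializes_to_divide:
  assumes "specializes_to z f v" "specializes_to z g w" "w \<noteq> 0"
  shows "specializes_to z (f / g) (v / w)"
  unfolding divide_inverse
  by (intro specializes_to_mult specializes_to_inverse assms)

lemma specializes_to_minus:
  "specializes_to z f v \<Longrightarrow> specializes_to z (- f) (- v)"
  using specializes_to_diff[OF specializes_to_0, of z f v] by simp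

lemma specializes_to_2: "specializes_to z 2 2"
  unfolding one_add_one[symmetric] by (intro specializes_to_add specializes_to_1)

lemma specializes_to_power:
  "specializes_to z f v \<Longrightarrow> specializes_to z (f ^ k) (v ^ k)"
  by (induction k) (simp_all add: specializes_to_1 specializes_to_mult)

lemma specializes_to_sum:
  "(\<And>i. i \<in> A \<Longrightarrow> specializes_to z (f i) (v i)) \<Longrightarrow> specializes_to z (sum f A) (sum v A)"
  by (induction A rule: infinite_finite_induct)
    (simp_all add: specializes_to_0 specializes_to_add)

lemma specializes_to_prod:
  "(\<And>i. i \<in> A \<Longrightarrow> specializes_to z (f i) (v i)) \<Longrightarrow> specializes_to z (prod f A) (prod v A)"
  by (induction A rule: infinite_finite_induct)
    (simp_all add: specializes_to_1 specializes_to_mult)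

text \<open>
  The denominator in lowest terms divides every other denominator of \<open>f\<close>, so it inherits
  nonvanishing at \<open>z\<close>.
\<close>

lemma specializes_to_quot_of_fract:
  assumes "specializes_to z f v"
  shows "poly (cpoly (snd (quot_of_fract f))) z \<noteq> 0"
    and "poly (cpoly (fst (quot_of_fract f))) z = v * poly (cpoly (snd (quot_of_fract f))) z"
proof -
  obtain a b where f: "f = to_fract a / to_fract b" "b \<noteq> 0" "poly (cpoly b) z \<noteq> 0"
    "v = poly (cpoly a) z / poly (cpoly b) z" using assms(1) by (rule specializes_toE)
  define N D where "N = fst (quot_of_fract f)" and "D = snd (quot_of_fract f)"
  have D0: "D \<noteq> 0" by (simp add: D_def)
  have "to_fract N / to_fract D = f" unfolding N_def D_def
    by (simp flip: Fract_conv_to_fract)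
  then have "to_fract (a * D) = to_fract (N * b)" using f(1,2) D0 by (simp add: frac_eq_eq)
  then have eq: "a * D = N * b" by (simp only: to_fract_eq_iff)
  have "coprime N D" unfolding N_def D_def by (rule coprime_quot_of_fract)
  moreover have "D dvd N * b" unfolding eq[symmetric] by simp
  ultimately have "D dvd b" by (simp add: coprime_dvd_mult_right_iff coprime_commute)
  then obtain e where "b = D * e" by blast
  then show nz: "poly (cpoly (snd (quot_of_fract f))) z \<noteq> 0"
    using f(3) by (auto simp: cpoly_mult D_def)
  have eval: "poly (cpoly N) z * poly (cpoly b) z = poly (cpoly a) z * poly (cpoly D) z"
    using arg_cong[OF eq, of "\<lambda>p. poly (cpoly p) z"] by (simp add: cpoly_mult)
  then show "poly (cpoly (fst (quot_of_fract f))) z = v * poly (cpoly (snd (quot_of_fract f))) z"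
  proof -
    have "poly (cpoly a) z = v * poly (cpoly b) z" using f(3,4) by simp
    with eval have "poly (cpoly N) z * poly (cpoly b) z = (v * poly (cpoly D) z) * poly (cpoly b) z"
      by (simp only: mult_ac)
    then show ?thesis using f(3) unfolding N_def [symmetric] D_def [symmetric]
      by (rule mult_right_cancel[THEN iffD1, rotated])
  qed
qed

text \<open>
  Divisibility descends from \<open>\<complex>\<close> to \<open>\<rat>\<close> because division with remainder commutes with the field extension.
\<close>

lemma cpoly_dvd_iff: "cpoly a dvd cpoly b \<longleftrightarrow> a dvd b"
proof
  assume "cpoly a dvd cpoly b"
  then obtain R where R: "cpoly b = cpoly a * R" by blast
  show "a dvd b"
  proof (cases "a = 0")
    case True
    then have "cpoly b = cpoly 0" using R by simp
    then show ?thesis using cpoly_inj True by blast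
  next
    case False
    have "cpoly b = cpoly a * cpoly (b div a) + cpoly (b mod a)"
      by (metis cpoly_add cpoly_mult mult_div_mod_eq)
    with R have r: "cpoly (b mod a) = cpoly a * (R - cpoly (b div a))"
      by (simp add: algebra_simps)
    have "b mod a = 0"
    proof (rule ccontr)
      assume nz: "b mod a \<noteq> 0"
      then have "degree (b mod a) < degree a" using degree_mod_less[OF False] by blast
      moreover have "cpoly (b mod a) \<noteq> 0" using nz cpoly_inj[of "b mod a" 0] by auto
      then have "degree (cpoly (b mod a)) \<ge> degree (cpoly a)"
        using r by (intro dvd_imp_degree_le) auto
      ultimately show False by (simp add: degree_cpoly)
    qed
    then show ?thesis by (simp add: mod_eq_0_iff_dvd)
  qed
next
  assume "a dvd b"
  then show "cpoly a dvd cpoly b" by (auto simp: cpoly_mult)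
qed

lemma prod_linear_dvd:
  fixes P :: "'a::field poly"
  assumes "finite A" "inj_on r A" "\<And>i. i \<in> A \<Longrightarrow> poly P (r i) = 0"
  shows "(\<Prod>i\<in>A. [:- r i, 1:]) dvd P"
  using assms
proof (induction A rule: finite_induct)
  case (insert i A)
  then have "(\<Prod>i\<in>A. [:- r i, 1:]) dvd P" by (auto simp: inj_on_def)
  then obtain R where R: "P = (\<Prod>i\<in>A. [:- r i, 1:]) * R" by blast
  have "poly (\<Prod>i\<in>A. [:- r i, 1:]) (r i) \<noteq> 0"
    using insert.hyps insert.prems(1) by (auto simp: poly_prod inj_on_def)
  then have "poly R (r i) = 0" using insert.prems(2)[of i] R by simp
  then have "[:- r i, 1:] dvd R" by (simp add: poly_eq_0_iff_dvd)
  then have "[:- r i, 1:] * (\<Prod>i\<in>A. [:- r i, 1:]) dvd R * (\<Prod>i\<in>A. [:- r i, 1:])"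
    by (intro mult_dvd_mono dvd_refl)
  also have "R * (\<Prod>i\<in>A. [:- r i, 1:]) = P" using R by (simp only: mult.commute)
  finally show ?case unfolding prod.insert[OF insert.hyps] .
qed simp

definition primitive_root :: "nat \<Rightarrow> complex \<Rightarrow> bool" where
  "primitive_root n z \<longleftrightarrow> (\<forall>j. z ^ j = 1 \<longleftrightarrow> n dvd j)"

lemma cis_power_eq_1_iff:
  assumes "n > 0"
  shows "cis (2 * pi / real n) ^ m = 1 \<longleftrightarrow> n dvd m"
proof -
  let ?f = "\<lambda>k. cis (2 * pi * real k / real n)"
  have pow: "cis (2 * pi / real n) ^ k = ?f k" for k
    by (simp add: DeMoivre mult_ac)
  have "cis (2 * pi / real n) ^ n = 1" using assms by (simp add: DeMoivre)
  then have "cis (2 * pi / real n) ^ m = cis (2 * pi / real n) ^ (m mod n)"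
    by (metis div_mult_mod_eq mult.commute mult.left_neutral power_add power_mult power_one)
  also have "\<dots> = ?f (m mod n)" by (rule pow)
  finally have "cis (2 * pi / real n) ^ m = 1 \<longleftrightarrow> ?f (m mod n) = ?f 0" by simp
  also have "\<dots> \<longleftrightarrow> m mod n = 0"
    using bij_betw_roots_unity[OF assms] assms
    by (intro inj_on_eq_iff[of ?f "{..<n}"]) (auto simp: bij_betw_def)
  finally show ?thesis by (simp add: mod_eq_0_iff_dvd)
qed

lemma primitive_root_cis_power:
  assumes "n > 0" "coprime k n"
  shows "primitive_root n (cis (2 * pi / real n) ^ k)"
  unfolding primitive_root_def power_mult [symmetric] cis_power_eq_1_iff[OF assms(1)]
  using assms(2) by (simp add: coprime_dvd_mult_right_iff coprime_commute)

lemma cyclotomic_dvdI: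
  assumes "n > 0" "\<And>z. primitive_root n z \<Longrightarrow> poly (cpoly p) z = 0"
  shows "cyclotomic n dvd p"
proof -
  let ?z = "cis (2 * pi / real n)"
  have "ccyclotomic n dvd cpoly p"
    unfolding ccyclotomic_def
  proof (rule prod_linear_dvd)
    show "inj_on (\<lambda>k. ?z ^ k) {k. 1 \<le> k \<and> k \<le> n \<and> coprime k n}"
    proof (rule linorder_inj_onI')
      fix i j assume ij: "i \<in> {k. 1 \<le> k \<and> k \<le> n \<and> coprime k n}"
        "j \<in> {k. 1 \<le> k \<and> k \<le> n \<and> coprime k n}" "i < j"
      then have "\<not> n dvd j - i" by (auto dest: dvd_imp_le)
      then have "?z ^ (j - i) \<noteq> 1" using cis_power_eq_1_iff[OF assms(1)] by blast
      moreover have "?z ^ j = ?z ^ i * ?z ^ (j - i)" using ij by (simp flip: power_add)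
      ultimately show "?z ^ i \<noteq> ?z ^ j" by auto
    qed
  qed (use assms primitive_root_cis_power in auto)
  then show ?thesis by (simp add: cpoly_dvd_iff flip: map_poly_cyclotomic)
qed

lemma cyclotomic_dvd_monom_minus_1:
  assumes "n > 0"
  shows "cyclotomic n dvd monom 1 n - 1"
  by (rule cyclotomic_dvdI[OF assms])
    (auto simp: cpoly_monom_minus_1 poly_monom primitive_root_def)

lemma coprime_cyclotomicI:
  assumes "n > 0" "\<And>z. primitive_root n z \<Longrightarrow> poly (cpoly p) z \<noteq> 0"
  shows "coprime (cyclotomic n) p"
proof (rule coprimeI)
  fix c assume c: "c dvd cyclotomic n" "c dvd p"
  have "degree c = 0"
  proof (rule ccontr)
    assume "degree c \<noteq> 0"
    then have "\<not> constant (poly (cpoly c))" by (simp add: constant_degree degree_cpoly)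
    then obtain z where z: "poly (cpoly c) z = 0" using fundamental_theorem_of_algebra by blast
    have "cpoly c dvd ccyclotomic n" using c(1) by (simp add: cpoly_dvd_iff flip: map_poly_cyclotomic)
    then have "poly (ccyclotomic n) z = 0" using z by auto
    then have "primitive_root n z"
      using primitive_root_cis_power[OF assms(1)] by (auto simp: ccyclotomic_def poly_prod)
    moreover have "poly (cpoly p) z = 0" using z c(2) cpoly_dvd_iff[of c p] by auto
    ultimately show False using assms(2) by blast
  qed
  moreover have "c \<noteq> 0"
  proof
    assume "c = 0"
    then have "cyclotomic n = 0" using c(1) by simp
    then show False using map_poly_cyclotomic[of n] ccyclotomic_nonzero[of n] by simp
  qed
  ultimately show "is_unit c" by (simp add: is_unit_iff_degree)
qed

text \<open>
  Two of the three factors \<open>\<Phi>\<^sub>n\<close> come from \<open>(1 - q^n)\<^sup>2\<close> and the third from the zeros of \<open>g\<close>. Regularity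
  of \<open>g\<close> at the primitive roots keeps \<open>\<Phi>\<^sub>n\<close> out of its denominator.
\<close>

lemma cyclotomic_cube_dvdI:
  assumes n: "n > 0" and g: "\<And>z. primitive_root n z \<Longrightarrow> specializes_to z g 0"
  shows "cyclotomic n ^ 3 dvd fst (quot_of_fract ((1 - qvar ^ n)^2 * g))"
proof -
  let ?\<Phi> = "cyclotomic n"
  define f where "f = (1 - qvar ^ n)^2 * g"
  define N D where "N = fst (quot_of_fract f)" and "D = snd (quot_of_fract f)"
  define A B where "A = fst (quot_of_fract g)" and "B = snd (quot_of_fract g)"
  have nz: "D \<noteq> 0" "B \<noteq> 0" by (simp_all add: D_def B_def)
  have f: "to_fract N / to_fract D = f" and g': "to_fract A / to_fract B = g"
    unfolding N_def D_def A_def B_def by (simp_all flip: Fract_conv_to_fract)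
  have "to_fract (monom 1 n) = qvar ^ n"
  proof (induction n)
    case (Suc n)
    have "(monom 1 (Suc n) :: rat poly) = [:0, 1:] * monom 1 n" by (simp add: monom_Suc)
    then show ?case unfolding qvar_def using Suc by (simp only: to_fract_mult power_Suc qvar_def)
  qed simp
  then have "to_fract ((1 - monom 1 n)^2) = (1 - qvar ^ n)^2"
    by (simp add: power2_eq_square)
  then have "to_fract N / to_fract D = to_fract ((1 - monom 1 n)^2) * (to_fract A / to_fract B)"
    using f g' by (simp add: f_def)
  then have "to_fract (N * B) = to_fract ((1 - monom 1 n)^2 * A * D)"
    using nz by (simp add: field_simps)
  then have eq: "N * B = (1 - monom 1 n)^2 * A * D" by (simp only: to_fract_eq_iff)
  have "?\<Phi> dvd 1 - monom 1 n"
    using cyclotomic_dvd_monom_minus_1[OF n] by (subst dvd_minus_iff[symmetric]) simp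
  then have "?\<Phi> ^ 2 dvd (1 - monom 1 n)^2" by (rule dvd_power_same)
  moreover have "?\<Phi> dvd A"
    unfolding A_def using specializes_to_quot_of_fract(2)[OF g] by (intro cyclotomic_dvdI[OF n]) simp
  ultimately have "?\<Phi> ^ 2 * ?\<Phi> dvd (1 - monom 1 n)^2 * A" by (rule mult_dvd_mono)
  then have "?\<Phi> ^ 3 dvd N * B" unfolding eq by (simp add: power2_eq_square power3_eq_cube)
  moreover have "coprime ?\<Phi> B"
    unfolding B_def using specializes_to_quot_of_fract(1)[OF g] by (rule coprime_cyclotomicI[OF n])
  then have "coprime (?\<Phi> ^ 3) B" by simp
  ultimately have "?\<Phi> ^ 3 dvd N" by (simp add: coprime_dvd_mult_left_iff)
  then show ?thesis by (simp add: N_def f_def)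
qed

section \<open>Specialization of the deformation\<close>

lemma specializes_to_qfactorial:
  assumes "specializes_to z x x'" "specializes_to z p p'"
  shows "specializes_to z (qfactorial x p k) (qfactorial x' p' k)"
  unfolding qfactorial_def
  by (intro specializes_to_prod specializes_to_diff specializes_to_1 specializes_to_mult
      specializes_to_power assms)

lemma specializes_to_quad:
  assumes "specializes_to z u u'"
  shows "specializes_to z (poly (quad qvar j) u) (poly (quad z j) u')"
  unfolding poly_quad
  by (intro specializes_to_add specializes_to_diff specializes_to_1 specializes_to_mult
      specializes_to_power specializes_to_qvar assms)

lemma specializes_to_odd_prod:
  assumes "specializes_to z u u'"
  shows "specializes_to z (poly (odd_prod qvar k) u) (poly (odd_prod z k) u')"
  unfolding odd_prod_def poly_prod by (intro specializes_to_prod specializes_to_quad assms)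

lemma specializes_to_odd_prod_quotient:
  assumes "specializes_to z u u'" "specializes_to z v v'"
  shows "specializes_to z (odd_prod_quotient qvar u v k) (odd_prod_quotient z u' v' k)"
proof (induction k)
  case 0
  show ?case by (simp add: specializes_to_0)
next
  case (Suc k)
  then show ?case unfolding odd_prod_quotient.simps
    by (intro specializes_to_diff specializes_to_mult specializes_to_power specializes_to_qvar
        specializes_to_quad specializes_to_odd_prod assms)
qed

lemma specializes_to_legendre_weight:
  assumes "\<And>j. 1 \<le> j \<Longrightarrow> j \<le> k \<Longrightarrow> (z^2) ^ (2 * j) \<noteq> 1"
  shows "specializes_to z (legendre_weight (qvar^2) k) (legendre_weight (z^2) k)"
proof -
  have "qfactorial (z^2) (z^2) k \<noteq> 0"
  proof (rule qfactorial_nonzero)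
    fix j assume "j < k"
    then have "(z^2) ^ (2 * Suc j) \<noteq> 1" by (intro assms) auto
    then have "((z^2) ^ Suc j)^2 \<noteq> 1" unfolding power_even_eq .
    then have "(z^2) ^ Suc j \<noteq> 1" by (metis power_one)
    then show "z^2 * (z^2) ^ j \<noteq> 1" by simp
  qed
  moreover have "qfactorial ((z^2)^2) ((z^2)^2) k \<noteq> 0"
  proof (rule qfactorial_nonzero)
    fix j assume "j < k"
    then have "(z^2) ^ (2 * Suc j) \<noteq> 1" by (intro assms) auto
    then show "(z^2)^2 * ((z^2)^2) ^ j \<noteq> 1" unfolding power_mult power_Suc .
  qed
  ultimately show ?thesis
    unfolding legendre_weight_def
    by (intro specializes_to_mult specializes_to_divide specializes_to_qfactorial
        specializes_to_power specializes_to_qvar) simp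
qed

lemma qvar_power_neq_1: "j > 0 \<Longrightarrow> qvar ^ j \<noteq> 1"
proof
  assume j: "j > 0" "qvar ^ j = 1"
  have "qvar ^ j = to_fract ([:0, 1:] ^ j)"
    unfolding qvar_def by (induction j) (simp_all only: power_0 to_fract_1 power_Suc to_fract_mult)
  with j(2) have "([:0, 1:] ^ j :: rat poly) = 1" by (metis to_fract_1 to_fract_eq_iff)
  then have "poly ([:0, 1:] ^ j :: rat poly) 0 = 1" by simp
  then show False using j(1) by (simp add: zero_power)
qed

lemma qvar_nonzero: "qvar \<noteq> 0"
  using qvar_power_neq_1[of 1] by (simp add: qvar_def)

section \<open>The congruence\<close>

theorem theorem1p1:
  fixes n :: nat
  assumes "n > 0" and "n mod 4 = 1"
  shows "ratfun_cong
    (\<Sum>k = 0..(n - 1) div 2.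
       qfactorial qvar (qvar ^ 2) k ^ 2 * qfactorial (qvar ^ 2) (qvar ^ 4) k /
       (qfactorial (qvar ^ 2) (qvar ^ 2) k ^ 2 * qfactorial (qvar ^ 4) (qvar ^ 4) k) *
       qvar ^ (2 * k))
    (qvar ^ ((n - 1) div 2) *
       (qfactorial (qvar ^ 2) (qvar ^ 4) ((n - 1) div 4) ^ 2 /
        qfactorial (qvar ^ 4) (qvar ^ 4) ((n - 1) div 4) ^ 2) *
       (1 + 2 * qint n ^ 2 *
          (\<Sum>i = 1..(n - 1) div 4. qvar ^ (4 * i - 2) / qint (4 * i - 2) ^ 2)))
    (cyclotomic n ^ 3)"
proof -
  define M where "M = n div 4"
  have n: "n = 4 * M + 1" using assms(2) unfolding M_def by (metis div_mult_mod_eq mult.commute)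
  have H: "(n - 1) div 2 = 2 * M" and M: "(n - 1) div 4 = M" using n by auto
  let ?Q = "qvar ^ n"
  define u where "u = node qvar (2 * M)"
  define E where "E = poly (deformed_sum qvar (2 * M)) u"
  define D where "D = deformed_sum_quotient qvar (2 * M) 2 u"
  define T where "T = (\<Sum>i<M. qvar ^ (4 * i + 2) / (1 - qvar ^ (4 * i + 2))^2)"
  \<comment> \<open>the difference of the two sides divided by \<open>(1 - q^n)\<^sup>2\<close>\<close>
  define g where "g = - (D / ?Q) - 2 * E * T"
  have Q0: "?Q \<noteq> 0" using qvar_nonzero by simp
  have q4: "(qvar^2)^2 = qvar^4" by (simp flip: power_mult)
  have q2: "(qvar^2)^k = qvar^(2 * k)" for k by (simp only: power_mult)
  have u: "u = ?Q + inverse ?Q" by (simp add: u_def node_def n)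

  have lhs: "(\<Sum>k = 0..(n - 1) div 2.
       qfactorial qvar (qvar ^ 2) k ^ 2 * qfactorial (qvar ^ 2) (qvar ^ 4) k /
       (qfactorial (qvar ^ 2) (qvar ^ 2) k ^ 2 * qfactorial (qvar ^ 4) (qvar ^ 4) k) *
       qvar ^ (2 * k)) = poly (deformed_sum qvar (2 * M)) 2"
    unfolding H deformed_sum_def poly_sum poly_smult poly_odd_prod_2 legendre_weight_def q4
      atLeast0AtMost unfolding q2 by (simp only: times_divide_eq_right times_divide_eq_left mult_ac)
  have "E = legendre_sum (qvar^2) (2 * M)"
    unfolding E_def u_def by (rule poly_deformed_sum_node[OF qvar_nonzero order_refl])
  also have "\<dots> = (qvar^2) ^ M * (qfactorial (qvar^2) ((qvar^2)^2) M / qfactorial ((qvar^2)^2) ((qvar^2)^2) M)^2"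
  proof (rule legendre_sum_even)
    show "(qvar^2) ^ (2 * j) \<noteq> 1" if "1 \<le> j" for j
      using qvar_power_neq_1[of "2 * (2 * j)"] that unfolding q2 by simp
  qed (simp add: qvar_nonzero)
  finally have E: "qvar ^ ((n - 1) div 2) *
       (qfactorial (qvar ^ 2) (qvar ^ 4) ((n - 1) div 4) ^ 2 /
        qfactorial (qvar ^ 4) (qvar ^ 4) ((n - 1) div 4) ^ 2) = E"
    unfolding q4 H M unfolding q2 by (simp only: power_divide)
  have qint_ratio: "qint n ^ 2 * (qvar ^ j / qint j ^ 2) = (1 - ?Q)^2 * (qvar ^ j / (1 - qvar ^ j)^2)" for j
    using qvar_power_neq_1[of 1] by (simp add: qint_def power_divide)
  have "qint n ^ 2 * (\<Sum>i = 1..(n - 1) div 4. qvar ^ (4 * i - 2) / qint (4 * i - 2) ^ 2) =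
      (\<Sum>i = 1..M. (1 - ?Q)^2 * (qvar ^ (4 * i - 2) / (1 - qvar ^ (4 * i - 2))^2))"
    unfolding M sum_distrib_left qint_ratio ..
  also have "\<dots> = (\<Sum>i<M. (1 - ?Q)^2 * (qvar ^ (4 * i + 2) / (1 - qvar ^ (4 * i + 2))^2))"
  proof -
    have "4 * Suc i - 2 = 4 * i + 2" for i by simp
    then show ?thesis by (simp only: One_nat_def sum.atLeast1_atMost_eq)
  qed
  finally have rhs: "qint n ^ 2 * (\<Sum>i = 1..(n - 1) div 4. qvar ^ (4 * i - 2) / qint (4 * i - 2) ^ 2) =
      (1 - ?Q)^2 * T"
    by (simp only: T_def sum_distrib_left)

  have "poly (deformed_sum qvar (2 * M)) 2 - E = (2 - u) * D"
    unfolding E_def D_def by (rule deformed_sum_diff)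
  also have "2 - u = - ((1 - ?Q)^2 / ?Q)"
    unfolding u using Q0 by (simp add: field_simps power2_eq_square)
  finally have S: "poly (deformed_sum qvar (2 * M)) 2 = E - (1 - ?Q)^2 / ?Q * D"
    by (simp add: algebra_simps)
  have diff: "poly (deformed_sum qvar (2 * M)) 2 - E * (1 + 2 * ((1 - ?Q)^2 * T)) = (1 - ?Q)^2 * g"
    unfolding S g_def by (simp add: algebra_simps)

  have "specializes_to z g 0" if "primitive_root n z" for z
  proof -
    have root: "z ^ j = 1 \<longleftrightarrow> n dvd j" for j using that unfolding primitive_root_def by blast
    have zn: "z ^ n = 1" using root by simp
    have "specializes_to z u (z ^ n + inverse (z ^ n))"
      unfolding u using zn
      by (intro specializes_to_add specializes_to_inverse specializes_to_power specializes_to_qvar) simp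
    \<comment> \<open>at \<open>z\<close> the node meets \<open>2\<close>, so the difference quotient turns into a derivative\<close>
    then have u2: "specializes_to z u 2" by (simp add: zn)
    have weight: "specializes_to z (legendre_weight (qvar^2) k) (legendre_weight (z^2) k)"
      if "k \<in> {..2 * M}" for k
      using root_square_power_neq_1[OF n root] that
      by (intro specializes_to_legendre_weight) auto
    have "specializes_to z E (poly (deformed_sum z (2 * M)) 2)"
      unfolding E_def deformed_sum_def poly_sum poly_smult
      by (intro specializes_to_sum specializes_to_mult weight specializes_to_odd_prod u2)
    moreover have "specializes_to z D (poly (pderiv (deformed_sum z (2 * M))) 2)"
      unfolding D_def deformed_sum_quotient_def deformed_sum_quotient_diagonal [symmetric]
      by (intro specializes_to_sum specializes_to_mult weight specializes_to_odd_prod_quotient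
          specializes_to_2 u2)
    moreover have "specializes_to z T (\<Sum>i<M. z ^ (4 * i + 2) / (1 - z ^ (4 * i + 2))^2)"
      unfolding T_def
    proof (intro specializes_to_sum specializes_to_divide specializes_to_power specializes_to_diff
        specializes_to_1 specializes_to_qvar)
      fix i assume "i \<in> {..<M}"
      then have "z ^ (4 * i + 2) \<noteq> 1" using n by (intro root_power_neq_1[OF n root]) auto
      then show "(1 - z ^ (4 * i + 2))^2 \<noteq> 0" by simp
    qed
    moreover have "specializes_to z ?Q 1"
      using specializes_to_power[OF specializes_to_qvar, of z n] zn by simp
    ultimately have "specializes_to z g (- (poly (pderiv (deformed_sum z (2 * M))) 2 / 1) -
        2 * poly (deformed_sum z (2 * M)) 2 * (\<Sum>i<M. z ^ (4 * i + 2) / (1 - z ^ (4 * i + 2))^2))"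
      unfolding g_def
      by (intro specializes_to_diff specializes_to_minus specializes_to_divide specializes_to_mult
          specializes_to_2) simp_all
    then show ?thesis unfolding log_derivative_at_root[OF n root] by simp
  qed
  then have "cyclotomic n ^ 3 dvd fst (quot_of_fract ((1 - ?Q)^2 * g))"
    by (rule cyclotomic_cube_dvdI[OF assms(1)])
  then show ?thesis
    unfolding ratfun_cong_def lhs E mult.assoc[of 2] rhs diff .
qed

end
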